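(* Let $(K,d)$ be a compact metric space and let $f:K\to K$ be Ruelle-expanding. Then the zeta function $\zeta_f$ is a rational function.
   Context: A continuous map $f:K\to K$ of a compact metric space $(K,d)$ is Ruelle-expanding if there are $r>0$, $0<\lambda<1$ and $c>0$ such that: (i) for all $x,y\in K$, if $x\neq y$ and $f(x)=f(y)$ then $d(x,y)>c$; (ii) for every $x\in K$ and every $a\in f^{-1}(\{x\})$ there is a map $\phi:B_r(x)\to K$ (with $B_r(x)$ the open ball of radius $r$ centered at $x$) such that $\phi(x)=a$, $f(\phi(y))=y$ for all $y\in B_r(x)$, and $d(\phi(y),\phi(z))\le\lambda d(y,z)$ for all $y,z\in B_r(x)$. For $n\in\mathbb N=\{1,2,\dots\}$, $N_n(f)$ is the number of points $x\in K$ with $f^n(x)=x$ (this is finite for Ruelle-expanding maps). The zeta function of $f$ is the power series $\zeta_f(z)=\exp\left(\sum_{n=1}^\infty\frac{N_n(f)}{n}z^n\right)$, $z$ complex. *)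

theory Defs
  imports
    "HOL-Analysis.Analysis"
    "HOL-Computational_Algebra.Computational_Algebra"
begin

(* The compact space K is a subset of a metric space type, so the ball B_r(x) of K is
   ball x r \<inter> K. The values of f and of the local inverses phi outside K are irrelevant. *)
definition Ruelle_expanding :: "'a::metric_space set \<Rightarrow> ('a \<Rightarrow> 'a) \<Rightarrow> bool" where
  "Ruelle_expanding K f \<longleftrightarrow>
     f ` K \<subseteq> K \<and> continuous_on K f \<and>
     (\<exists>r lam c :: real. 0 < r \<and> 0 < lam \<and> lam < 1 \<and> 0 < c \<and>
        (\<forall>x\<in>K. \<forall>y\<in>K. x \<noteq> y \<and> f x = f y \<longrightarrow> dist x y > c) \<and>
        (\<forall>x\<in>K. \<forall>a\<in>K. f a = x \<longrightarrow>
           (\<exists>phi. phi ` (ball x r \<inter> K) \<subseteq> K \<and> phi x = a \<and>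
              (\<forall>y\<in>ball x r \<inter> K. f (phi y) = y) \<and>
              (\<forall>y\<in>ball x r \<inter> K. \<forall>z\<in>ball x r \<inter> K.
                 dist (phi y) (phi z) \<le> lam * dist y z))))"

(* For a Ruelle-expanding map of a compact space this set is finite when n \<ge> 1, so card
   is the true number of points. *)
definition num_fixpoints :: "'a set \<Rightarrow> ('a \<Rightarrow> 'a) \<Rightarrow> nat \<Rightarrow> nat" where
  "num_fixpoints K f n = card {x \<in> K. (f ^^ n) x = x}"

(* The exponential of a power series with constant term 0 is the composition (oo) of the
   exponential series with it. *)
definition zeta_fps :: "'a set \<Rightarrow> ('a \<Rightarrow> 'a) \<Rightarrow> complex fps" where
  "zeta_fps K f =
     fps_exp 1 oo Abs_fps (\<lambda>n. if n = 0 then 0 else of_nat (num_fixpoints K f n) / of_nat n)"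

(* Since q does not vanish at 0, the quotient below is the Taylor expansion of p/q at 0. *)
definition rational_fps :: "'b::field fps \<Rightarrow> bool" where
  "rational_fps F \<longleftrightarrow>
     (\<exists>p q :: 'b poly. poly q 0 \<noteq> 0 \<and> F = fps_of_poly p / fps_of_poly q)"

end

theory Submission
  imports Defs "Jordan_Normal_Form.Schur_Decomposition"
begin

text \<open>
  The number \<open>N n\<close> of solutions of \<open>f\<^sup>n x = x\<close> is shown to be a difference of
  two sums of \<open>n\<close>-th powers, \<open>N n = (\<Sum>a\<leftarrow>as. a ^ n) - (\<Sum>b\<leftarrow>bs.
  b ^ n)\<close> with fixed finite lists of complex numbers. Since \<open>exp (\<Sum>n\<ge>1. a\<^sup>n
  z\<^sup>n / n) = 1 / (1 - a z)\<close>, the zeta function is then the product of the \<open>1 - b z\<close>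
  over the product of the \<open>1 - a z\<close>. Sums of powers arise as traces of powers of a 0-1 matrix, that
  is, as numbers of closed walks in a finite directed graph; so the task is to write \<open>N n\<close> as a
  difference of two numbers of closed walks.

  The graph comes from a coding that runs backwards in time. Take a fine finite net \<open>X\<close> of
  \<open>K\<close>, the finite set \<open>E\<close> of all preimages of points of \<open>X\<close>, and a map
  \<open>\<alpha>\<close> sending each point to a net point near it. Draw an arrow from \<open>e\<close> to
  \<open>e'\<close> when \<open>f e = \<alpha> e'\<close>; a path of arrows is a pseudo-orbit. Let \<open>B
  x\<close> be the set of elements of \<open>E\<close> near \<open>x\<close>. Because inverse branches contract,
  each \<open>e'\<close> in \<open>B (f x)\<close> receives an arrow from exactly one element of \<open>B
  x\<close>: the branch of \<open>f\<close> inverse at \<open>x\<close> pulls \<open>\<alpha> e'\<close> back to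
  it. So the arrows, which know nothing of \<open>x\<close>, restrict to a map \<open>B (f x) \<rightarrow> B
  x\<close>, and a point \<open>x\<close> of period \<open>n\<close> yields a self-map \<open>G\<close> of the
  finite nonempty set \<open>B x\<close>.

  Each such \<open>x\<close> must be counted once, although \<open>G\<close> may have several cycles. Euler
  characteristics achieve this: the sets \<open>S \<subseteq> B x\<close>, \<open>S \<noteq> {}\<close>, with
  \<open>G ` S = S\<close> form a poset with a greatest element, so their nonempty chains, counted with sign
  \<open>(-1)\<close> to the length plus 1, contribute exactly 1 (\<open>sum_invariant_chains\<close>). Such
  chains correspond to the closed walks over the orbit of \<open>x\<close> of length \<open>n\<close> in the
  graph whose vertices are the chains of nonempty subsets of \<open>E\<close> of small diameter and whose edges
  apply the arrows elementwise (\<open>bij_betw_codes\<close>). Conversely, any closed walk in this graph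
  belongs to exactly one \<open>x\<close>, by shadowing and expansivity (\<open>exists_periodic_coding\<close>).
  Hence \<open>N n\<close> is the number of closed walks through chains of odd cardinality minus the number of
  those through chains of even cardinality.
\<close>

unbundle no vec_syntax

section \<open>Exponentials of power series and rationality\<close>

text \<open>
  An exponential is the only solution of its linear differential equation with value 1 at 0: the
  quotient of two solutions has derivative 0.
\<close>

lemma fps_exp_compose_eqI:
  fixes L F :: "'a::field_char_0 fps"
  assumes L0: "L $ 0 = 0" and F0: "F $ 0 = 1"
    and deriv: "fps_deriv F = fps_deriv L * F"
  shows "fps_exp 1 oo L = F"
proof -
  let ?E = "fps_exp 1 oo L" and ?I = "fps_exp (-1) oo L"
  have inv: "?E * ?I = 1"
    using fps_exp_add_mult[of "1::'a" "-1"] by (simp add: fps_compose_mult_distrib[OF L0, symmetric])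
  have dI: "fps_deriv ?I = - (fps_deriv L * ?I)"
    by (simp add: fps_compose_deriv[OF L0] fps_compose_mult_distrib[OF L0] fps_compose_uminus
        mult.commute flip: fps_const_neg)
  have "fps_deriv (F * ?I) = 0"
    by (simp add: dI deriv algebra_simps)
  then have "F * ?I = fps_const ((F * ?I) $ 0)"
    unfolding fps_deriv_eq_0_iff .
  also have "\<dots> = 1" using F0 by simp
  finally have FI: "F * ?I = 1" .
  have "?E = ?E * (F * ?I)" unfolding FI by simp
  also have "\<dots> = F * (?E * ?I)" by (simp only: mult_ac)
  also have "\<dots> = F" unfolding inv by simp
  finally show ?thesis .
qed

lemma fps_exp_compose_add:
  fixes a b :: "'a::field_char_0 fps"
  assumes "a $ 0 = 0" and "b $ 0 = 0"
  shows "fps_exp 1 oo (a + b) = (fps_exp 1 oo a) * (fps_exp 1 oo b)"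
  using assms by (intro fps_exp_compose_eqI) (simp_all add: fps_compose_deriv algebra_simps)

lemma rational_fps_iff:
  "rational_fps F \<longleftrightarrow> (\<exists>p q. poly q 0 \<noteq> 0 \<and> F * fps_of_poly q = fps_of_poly p)"
proof -
  have "F = fps_of_poly p / fps_of_poly q \<longleftrightarrow> F * fps_of_poly q = fps_of_poly p"
    if "poly q 0 \<noteq> 0" for p q :: "'a poly"
  proof -
    have "fps_of_poly q $ 0 \<noteq> 0" using that by (simp add: poly_0_coeff_0)
    from inverse_mult_eq_1[OF this] inverse_mult_eq_1'[OF this] show ?thesis
      by (auto simp: fps_divide_unit[OF \<open>fps_of_poly q $ 0 \<noteq> 0\<close>] mult.assoc)
        (metis mult.assoc mult_1_right)
  qed
  then show ?thesis unfolding rational_fps_def by blast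
qed

lemma rational_fps_mult:
  assumes "rational_fps F" and "rational_fps G"
  shows "rational_fps (F * G)"
proof -
  obtain p q p' q' where "poly q 0 \<noteq> 0" "F * fps_of_poly q = fps_of_poly p"
    and "poly q' 0 \<noteq> 0" "G * fps_of_poly q' = fps_of_poly p'"
    using assms unfolding rational_fps_iff by blast
  then have "poly (q * q') 0 \<noteq> 0" "(F * G) * fps_of_poly (q * q') = fps_of_poly (p * p')"
    by (simp, simp only: fps_of_poly_mult, metis mult.assoc mult.left_commute)
  then show ?thesis unfolding rational_fps_iff by blast
qed

lemma rational_fps_inverse:
  assumes "rational_fps F"
  shows "rational_fps (inverse F)"
proof (cases "F $ 0 = 0")
  case True
  then have "inverse F = 0" by simp
  then show ?thesis unfolding rational_fps_iff by (intro exI[of _ 0] exI[of _ 1]) simp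
next
  case False
  obtain p q where pq: "poly q 0 \<noteq> 0" "F * fps_of_poly q = fps_of_poly p"
    using assms unfolding rational_fps_iff by blast
  have "fps_of_poly p $ 0 = F $ 0 * fps_of_poly q $ 0" by (simp flip: pq(2))
  with False pq(1) have "poly p 0 \<noteq> 0" by (simp add: poly_0_coeff_0)
  moreover have "inverse F * fps_of_poly p = fps_of_poly q"
    using inverse_mult_eq_1[OF False] by (simp flip: pq(2) mult.assoc)
  ultimately show ?thesis unfolding rational_fps_iff by blast
qed

lemma exp_geometric_log:
  fixes a :: "'a::field_char_0"
  shows "fps_exp 1 oo Abs_fps (\<lambda>n. if n = 0 then 0 else a ^ n / of_nat n)
    = inverse (1 - fps_const a * fps_X)" (is "_ oo ?L = inverse ?D")
proof (rule fps_exp_compose_eqI)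
  have coeff: "fps_deriv ?L $ n = a ^ Suc n" for n
    by (simp del: of_nat_Suc)
  have "y * ?D = y - fps_const a * (fps_X * y)" for y
    by (simp add: algebra_simps)
  then have "fps_deriv ?L * ?D = fps_deriv ?L - fps_const a * (fps_X * fps_deriv ?L)" .
  also have "\<dots> = fps_const a"
  proof (rule fps_ext)
    fix n show "(fps_deriv ?L - fps_const a * (fps_X * fps_deriv ?L)) $ n = fps_const a $ n"
      by (cases n) (simp_all only: fps_sub_nth fps_mult_left_const_nth fps_X_mult_nth coeff
          fps_nth_fps_const, simp_all)
  qed
  finally have LD: "fps_deriv ?L * ?D = fps_const a" .
  have dD: "fps_deriv (inverse ?D) = fps_const a * inverse ?D ^ 2"
    by (simp add: fps_inverse_deriv)
  have unit: "?D * inverse ?D = 1" by (intro inverse_mult_eq_1') simp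
  have "fps_deriv (inverse ?D) = (fps_deriv ?L * ?D) * inverse ?D ^ 2"
    unfolding dD LD ..
  also have "\<dots> = fps_deriv ?L * (?D * inverse ?D) * inverse ?D"
    by (simp only: power2_eq_square mult.assoc)
  also have "\<dots> = fps_deriv ?L * inverse ?D" unfolding unit by simp
  finally show "fps_deriv (inverse ?D) = fps_deriv ?L * inverse ?D" .
qed simp_all

text \<open>
  The logarithmic generating function: the zeta function is \<open>fps_exp 1 oo log_fps N\<close> for the
  sequence \<open>N\<close> of numbers of periodic points.
\<close>

definition log_fps :: "(nat \<Rightarrow> 'a::field_char_0) \<Rightarrow> 'a fps" where
  "log_fps u = Abs_fps (\<lambda>n. if n = 0 then 0 else u n / of_nat n)"

text \<open>
  Each summand \<open>a ^ n\<close> contributes the factor \<open>1 / (1 - a z)\<close>.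
\<close>

lemma rational_exp_power_sum:
  fixes as :: "'a::field_char_0 list"
  shows "rational_fps (fps_exp 1 oo log_fps (\<lambda>n. \<Sum>a\<leftarrow>as. a ^ n))"
proof (induction as)
  case Nil
  have "log_fps (\<lambda>n. \<Sum>a\<leftarrow>[]. a ^ n) = (0 :: 'a fps)" by (simp add: log_fps_def fps_eq_iff)
  then show ?case unfolding rational_fps_iff by (intro exI[of _ 1]) (simp add: fps_exp_def)
next
  case (Cons a as)
  have "rational_fps (inverse (1 - fps_const a * fps_X))"
    unfolding rational_fps_iff
  proof (intro exI conjI)
    show "poly [:1, -a:] 0 \<noteq> 0" by simp
    have "fps_of_poly [:1, -a:] = 1 - fps_const a * fps_X"
      by (simp add: fps_of_poly_pCons mult.commute flip: fps_const_neg)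
    then show "inverse (1 - fps_const a * fps_X) * fps_of_poly [:1, -a:] = fps_of_poly 1"
      by (simp only: fps_of_poly_1) (intro inverse_mult_eq_1, simp)
  qed
  then have "rational_fps (fps_exp 1 oo log_fps (\<lambda>n. a ^ n))"
    unfolding log_fps_def exp_geometric_log .
  moreover have "log_fps (\<lambda>n. \<Sum>b\<leftarrow>a # as. b ^ n) = log_fps (\<lambda>n. a ^ n) + log_fps (\<lambda>n. \<Sum>b\<leftarrow>as. b ^ n)"
    by (simp add: log_fps_def fps_eq_iff add_divide_distrib)
  ultimately show ?case
    using Cons.IH by (simp add: fps_exp_compose_add log_fps_def rational_fps_mult)
qed

lemma rational_exp_diff:
  fixes u v :: "nat \<Rightarrow> 'a::field_char_0"
  assumes u: "rational_fps (fps_exp 1 oo log_fps u)" and v: "rational_fps (fps_exp 1 oo log_fps v)"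
  shows "rational_fps (fps_exp 1 oo log_fps (\<lambda>n. u n - v n))"
proof -
  let ?d = "log_fps (\<lambda>n. u n - v n)"
  have "log_fps u = ?d + log_fps v" by (simp add: log_fps_def fps_eq_iff diff_divide_distrib)
  then have eq: "fps_exp 1 oo log_fps u = (fps_exp 1 oo ?d) * (fps_exp 1 oo log_fps v)"
    by (simp add: fps_exp_compose_add log_fps_def)
  have "(fps_exp 1 oo log_fps v) $ 0 \<noteq> 0" by simp
  from inverse_mult_eq_1'[OF this]
  have "fps_exp 1 oo ?d = (fps_exp 1 oo log_fps u) * inverse (fps_exp 1 oo log_fps v)"
    unfolding eq by (simp add: mult.assoc)
  with u v show ?thesis by (simp add: rational_fps_mult rational_fps_inverse)
qed

section \<open>Closed walks in finite graphs\<close>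

lemma sum_diag_mult_commute:
  assumes A: "A \<in> carrier_mat n n" and B: "B \<in> carrier_mat n n"
  shows "(\<Sum>i<n. (A * B) $$ (i, i)) = (\<Sum>i<n. (B * A) $$ (i, i :: nat) :: 'a::comm_semiring_0)"
proof -
  have "(\<Sum>i<n. (A * B) $$ (i, i)) = (\<Sum>i<n. \<Sum>j<n. A $$ (i, j) * B $$ (j, i))"
    using A B by (simp add: scalar_prod_def atLeast0LessThan)
  also have "\<dots> = (\<Sum>j<n. \<Sum>i<n. B $$ (j, i) * A $$ (i, j))"
    by (subst sum.swap) (simp add: mult.commute)
  also have "\<dots> = (\<Sum>j<n. (B * A) $$ (j, j))"
    using A B by (simp add: scalar_prod_def atLeast0LessThan)
  finally show ?thesis .
qed

lemma upper_triangular_pow: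
  assumes B: "B \<in> carrier_mat n n" and ut: "upper_triangular B"
  shows "upper_triangular (B ^\<^sub>m k) \<and> (\<forall>i<n. (B ^\<^sub>m k) $$ (i, i) = (B $$ (i, i) :: 'a::comm_semiring_1) ^ k)"
proof (induction k)
  case 0
  then show ?case using B by simp
next
  case (Suc k)
  have C: "B ^\<^sub>m k \<in> carrier_mat n n" using B by simp
  have entry: "(B ^\<^sub>m k * B) $$ (i, j) = (\<Sum>l<n. (B ^\<^sub>m k) $$ (i, l) * B $$ (l, j))" if "i < n" "j < n" for i j
    using that B C by (simp add: scalar_prod_def atLeast0LessThan)
  \<comment> \<open>For \<open>j \<le> i\<close>, one of the two entries lies strictly below the diagonal unless \<open>i = l = j\<close>.\<close>
  have zero: "(B ^\<^sub>m k) $$ (i, l) * B $$ (l, j) = 0" if "i < n" "l < n" "j \<le> i" "l \<noteq> i \<or> j \<noteq> i" for i j l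
  proof (cases "l < i")
    case True
    then show ?thesis using Suc.IH that B C by (simp add: upper_triangularD)
  next
    case False
    with that have "j < l" by auto
    then show ?thesis using ut that B by (simp add: upper_triangularD)
  qed
  have "upper_triangular (B ^\<^sub>m k * B)"
  proof (rule upper_triangularI)
    fix i j assume "j < i" "i < dim_row (B ^\<^sub>m k * B)"
    then have "i < n" "j < n" "j \<le> i" "j \<noteq> i" using C by auto
    then show "(B ^\<^sub>m k * B) $$ (i, j) = 0"
      unfolding entry[OF \<open>i < n\<close> \<open>j < n\<close>] by (intro sum.neutral) (auto intro: zero)
  qed
  moreover have "(B ^\<^sub>m k * B) $$ (i, i) = B $$ (i, i) ^ Suc k" if "i < n" for i
  proof -
    have "(B ^\<^sub>m k * B) $$ (i, i) = (\<Sum>l<n. if l = i then (B ^\<^sub>m k) $$ (i, i) * B $$ (i, i) else 0)"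
      unfolding entry[OF that that] using that by (intro sum.cong) (auto simp: zero)
    also have "\<dots> = B $$ (i, i) ^ Suc k"
      using that Suc.IH by (simp add: mult.commute)
    finally show ?thesis .
  qed
  ultimately show ?case by simp
qed

text \<open>
  The numbers in question are the eigenvalues with multiplicity: by Schur's theorem \<open>A\<close> is similar to
  a triangular matrix, whose powers have the powers of its diagonal on their diagonals, and the trace
  does not change under similarity.
\<close>

lemma trace_pow_eq_power_sum:
  fixes A :: "complex mat"
  assumes A: "A \<in> carrier_mat n n"
  shows "\<exists>as. \<forall>k. (\<Sum>i<n. (A ^\<^sub>m k) $$ (i, i)) = (\<Sum>a\<leftarrow>as. a ^ k)"
proof -
  obtain es where "char_poly A = (\<Prod>a\<leftarrow>es. [:- a, 1:])"
    using char_poly_factorized[OF A] by blast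
  from schur_decomposition_exists[OF A this] obtain B P Q
    where B: "B \<in> carrier_mat n n" "upper_triangular B" and sim: "similar_mat_wit A B P Q"
    unfolding similar_mat_def by blast
  note wit = similar_mat_witD2[OF A sim]
  have "(\<Sum>i<n. (A ^\<^sub>m k) $$ (i, i)) = (\<Sum>a\<leftarrow>map (\<lambda>i. B $$ (i, i)) [0..<n]. a ^ k)" for k
  proof -
    have C: "B ^\<^sub>m k \<in> carrier_mat n n" using B by simp
    have "(\<Sum>i<n. (A ^\<^sub>m k) $$ (i, i)) = (\<Sum>i<n. (P * (B ^\<^sub>m k * Q)) $$ (i, i))"
      unfolding similar_mat_wit_pow_id[OF sim] using assoc_mult_mat[OF wit(6) C wit(7)] by simp
    also have "\<dots> = (\<Sum>i<n. (B ^\<^sub>m k * Q * P) $$ (i, i))"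
      using C wit by (intro sum_diag_mult_commute) auto
    also have "B ^\<^sub>m k * Q * P = B ^\<^sub>m k"
      using assoc_mult_mat[OF C wit(7) wit(6)] wit(2) right_mult_one_mat[OF C] by simp
    also have "(\<Sum>i<n. (B ^\<^sub>m k) $$ (i, i)) = (\<Sum>i<n. B $$ (i, i) ^ k)"
      using upper_triangular_pow[OF B] by simp
    also have "\<dots> = (\<Sum>a\<leftarrow>map (\<lambda>i. B $$ (i, i)) [0..<n]. a ^ k)"
      by (simp add: interv_sum_list_conv_sum_set_nat atLeast0LessThan comp_def)
    finally show ?thesis .
  qed
  then show ?thesis by blast
qed

text \<open>
  A closed walk has a base point: it is a periodic sequence indexed by all of \<open>nat\<close>, so that no index
  needs reduction modulo \<open>n\<close> and the walk reads as a forward pseudo-orbit.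
\<close>

definition closed_walks :: "'v set \<Rightarrow> ('v \<Rightarrow> 'v \<Rightarrow> bool) \<Rightarrow> nat \<Rightarrow> (nat \<Rightarrow> 'v) set" where
  "closed_walks V Q n = {w. \<forall>i. w i \<in> V \<and> Q (w i) (w (Suc i)) \<and> w (i + n) = w i}"

text \<open>
  Open walks between given ends, as lists, serve to relate closed walks to matrix powers.
\<close>

definition walks :: "'v set \<Rightarrow> ('v \<Rightarrow> 'v \<Rightarrow> bool) \<Rightarrow> nat \<Rightarrow> 'v \<Rightarrow> 'v \<Rightarrow> 'v list set" where
  "walks V Q n u v = {xs. length xs = Suc n \<and> set xs \<subseteq> V \<and>
     (\<forall>i<n. Q (xs ! i) (xs ! Suc i)) \<and> xs ! 0 = u \<and> xs ! n = v}"

lemma finite_walks: "finite V \<Longrightarrow> finite (walks V Q n u v)"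
  by (rule finite_subset[OF _ finite_lists_length_eq[of V "Suc n"]]) (auto simp: walks_def)

lemma walks_0: "u \<in> V \<Longrightarrow> walks V Q 0 u v = (if u = v then {[u]} else {})"
  by (auto simp: walks_def length_Suc_conv)

lemma walks_Suc:
  assumes "v \<in> V"
  shows "walks V Q (Suc n) u v = (\<Union>z\<in>{z\<in>V. Q z v}. (\<lambda>xs. xs @ [v]) ` walks V Q n u z)"
proof (intro equalityI subsetI)
  fix xs assume xs: "xs \<in> walks V Q (Suc n) u v"
  then obtain ys y where ys: "xs = ys @ [y]" "length ys = Suc n"
    by (auto simp: walks_def length_Suc_conv_rev)
  with xs have Q: "Q (xs ! i) (xs ! Suc i)" if "i \<le> n" for i
    using that by (auto simp: walks_def)
  have "ys \<in> walks V Q n u (ys ! n)" "ys ! n \<in> V" "Q (ys ! n) v" "y = v"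
    using xs ys Q by (auto simp: walks_def nth_append dest: spec[of _ 0]) (metis Suc_lessD Suc_less_eq Suc_leI less_Suc_eq_le nth_append Q)+
  then show "xs \<in> (\<Union>z\<in>{z\<in>V. Q z v}. (\<lambda>xs. xs @ [v]) ` walks V Q n u z)"
    using ys by blast
qed (use assms in \<open>auto simp: walks_def nth_append less_Suc_eq\<close>)

lemma pow_adjacency_mat:
  assumes e: "bij_betw e {..<m} V"
    and A: "A = mat m m (\<lambda>(i, j). of_bool (Q (e i) (e j)))" and ij: "i < m" "j < m"
  shows "(A ^\<^sub>m n) $$ (i, j) = (of_nat (card (walks V Q n (e i) (e j))) :: 'a::semiring_1)"
  using ij(2)
proof (induction n arbitrary: j)
  case 0
  have "e i = e j \<longleftrightarrow> i = j"
    using e ij 0 by (auto simp: bij_betw_def inj_on_def)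
  moreover have "e i \<in> V" using e ij by (auto simp: bij_betw_def)
  ultimately show ?case using ij 0 by (simp add: A walks_0)
next
  case (Suc n)
  have fin: "finite V" using e bij_betw_finite by blast
  have j: "e j \<in> V" using e Suc.prems by (auto simp: bij_betw_def)
  have "card (walks V Q (Suc n) (e i) (e j))
    = (\<Sum>z\<in>{z\<in>V. Q z (e j)}. card ((\<lambda>xs. xs @ [e j]) ` walks V Q n (e i) z))"
    unfolding walks_Suc[OF j] by (rule card_UN_disjoint) (use fin finite_walks[OF fin] in \<open>force simp: walks_def\<close>)+
  also have "\<dots> = (\<Sum>z\<in>{z\<in>V. Q z (e j)}. card (walks V Q n (e i) z))"
    by (intro sum.cong refl card_image) (simp add: inj_on_def)
  also have "\<dots> = (\<Sum>z\<in>V. card (walks V Q n (e i) z) * of_bool (Q z (e j)))"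
    by (intro sum.mono_neutral_cong_left) (use fin in auto)
  also have "\<dots> = (\<Sum>l<m. card (walks V Q n (e i) (e l)) * of_bool (Q (e l) (e j)))"
    by (rule sum.reindex_bij_betw[OF e, symmetric])
  finally have "of_nat (card (walks V Q (Suc n) (e i) (e j)))
    = (\<Sum>l<m. (A ^\<^sub>m n) $$ (i, l) * of_bool (Q (e l) (e j)))"
    using Suc.IH by simp
  also have "\<dots> = (A ^\<^sub>m n * A) $$ (i, j)"
    using ij Suc.prems by (simp add: A scalar_prod_def atLeast0LessThan)
  finally show ?case by simp
qed

lemma closed_walks_periodic:
  assumes "w \<in> closed_walks V Q n"
  shows "w (i + k * n) = w i"
proof (induction k)
  case (Suc k)
  have "w (i + k * n + n) = w (i + k * n)" using assms unfolding closed_walks_def by blast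
  with Suc show ?case by (simp add: algebra_simps)
qed simp

lemma bij_betw_closed_walks:
  assumes n: "n > 0"
  shows "bij_betw (\<lambda>w. map w [0..<Suc n]) (closed_walks V Q n) (\<Union>u\<in>V. walks V Q n u u)"
proof (rule bij_betwI[where g = "\<lambda>xs i. xs ! (i mod n)"])
  show "(\<lambda>w. map w [0..<Suc n]) \<in> closed_walks V Q n \<rightarrow> (\<Union>u\<in>V. walks V Q n u u)"
  proof
    fix w assume w: "w \<in> closed_walks V Q n"
    then have "w (0 + n) = w 0" unfolding closed_walks_def by blast
    with w have "map w [0..<Suc n] \<in> walks V Q n (w 0) (w 0)"
      by (auto simp: walks_def closed_walks_def nth_append simp del: upt_Suc)
    then show "map w [0..<Suc n] \<in> (\<Union>u\<in>V. walks V Q n u u)"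
      using w by (auto simp: closed_walks_def)
  qed
  show "(\<lambda>xs i. xs ! (i mod n)) \<in> (\<Union>u\<in>V. walks V Q n u u) \<rightarrow> closed_walks V Q n"
  proof
    fix xs assume "xs \<in> (\<Union>u\<in>V. walks V Q n u u)"
    then have xs: "length xs = Suc n" "set xs \<subseteq> V" "\<And>i. i < n \<Longrightarrow> Q (xs ! i) (xs ! Suc i)" "xs ! n = xs ! 0"
      by (auto simp: walks_def)
    have "xs ! (i mod n) \<in> V" for i
      using xs n by (metis less_SucI mod_less_divisor nth_mem subsetD)
    moreover have "Q (xs ! (i mod n)) (xs ! (Suc i mod n))" for i
      using xs(3)[of "i mod n"] xs(4) n by (auto simp: mod_Suc)
    ultimately show "(\<lambda>i. xs ! (i mod n)) \<in> closed_walks V Q n"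
      by (simp add: closed_walks_def)
  qed
next
  fix w assume w: "w \<in> closed_walks V Q n"
  from closed_walks_periodic[OF this] have "w (i mod n) = w i" for i
    by (metis add.commute mod_div_mult_eq mult.commute)
  then show "(\<lambda>i. map w [0..<Suc n] ! (i mod n)) = w"
    using n by (simp add: fun_eq_iff less_SucI del: upt_Suc)
next
  fix xs assume "xs \<in> (\<Union>u\<in>V. walks V Q n u u)"
  then have xs: "length xs = Suc n" "xs ! n = xs ! 0" by (auto simp: walks_def)
  show "map (\<lambda>i. xs ! (i mod n)) [0..<Suc n] = xs"
  proof (rule nth_equalityI)
    fix i assume "i < length (map (\<lambda>i. xs ! (i mod n)) [0..<Suc n])"
    then have "i < n \<or> i = n" by auto
    then show "map (\<lambda>i. xs ! (i mod n)) [0..<Suc n] ! i = xs ! i"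
      using xs by (auto simp del: upt_Suc)
  qed (use xs in simp)
qed

lemma finite_closed_walks:
  assumes "finite V" and "n > 0"
  shows "finite (closed_walks V Q n)"
  using bij_betw_finite[OF bij_betw_closed_walks[OF assms(2), of V Q]] assms(1)
  by (simp add: finite_walks)

text \<open>
  The number of closed walks is the trace of a power of the adjacency matrix.
\<close>

lemma card_closed_walks_power_sum:
  assumes fin: "finite V"
  shows "\<exists>as :: complex list. \<forall>n>0. of_nat (card (closed_walks V Q n)) = (\<Sum>a\<leftarrow>as. a ^ n)"
proof -
  obtain e where e: "bij_betw e {..<card V} V"
    using ex_bij_betw_nat_finite[OF fin] by (auto simp: atLeast0LessThan)
  define A :: "complex mat" where "A = mat (card V) (card V) (\<lambda>(i, j). of_bool (Q (e i) (e j)))"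
  have "of_nat (card (closed_walks V Q n)) = (\<Sum>i<card V. (A ^\<^sub>m n) $$ (i, i))" if "n > 0" for n
  proof -
    have "card (closed_walks V Q n) = card (\<Union>u\<in>V. walks V Q n u u)"
      by (rule bij_betw_same_card[OF bij_betw_closed_walks[OF that]])
    also have "\<dots> = (\<Sum>u\<in>V. card (walks V Q n u u))"
      by (rule card_UN_disjoint) (use fin finite_walks[OF fin] in \<open>force simp: walks_def\<close>)+
    also have "\<dots> = (\<Sum>i<card V. card (walks V Q n (e i) (e i)))"
      by (rule sum.reindex_bij_betw[OF e, symmetric])
    finally show ?thesis
      by (simp add: pow_adjacency_mat[OF e A_def])
  qed
  moreover have "A \<in> carrier_mat (card V) (card V)" by (simp add: A_def)
  from trace_pow_eq_power_sum[OF this] obtain as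
    where "\<forall>k. (\<Sum>i<card V. (A ^\<^sub>m k) $$ (i, i)) = (\<Sum>a\<leftarrow>as. a ^ k)" by blast
  ultimately show ?thesis by auto
qed

section \<open>Chains of invariant subsets\<close>

text \<open>
  The reduced Euler characteristic of a poset with a greatest element \<open>T\<close> is 0: adding or removing
  \<open>T\<close> pairs off all chains, the empty one included, with opposite signs. Here the chain \<open>{T}\<close>, partner
  of the empty chain, remains and gives the 1.
\<close>

lemma sum_nonempty_chains_with_top:
  assumes fin: "finite I" and T: "T \<in> I" "\<And>S. S \<in> I \<Longrightarrow> S \<subseteq> T"
  shows "(\<Sum>c | c \<noteq> {} \<and> c \<subseteq> I \<and> chain_subset c. (-1) ^ (card c + 1)) = (1 :: int)"
proof -
  define P where "P = {c. c \<subseteq> I - {T} \<and> chain_subset c}"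
  have finP: "finite P" unfolding P_def by (rule finite_subset[of _ "Pow I"]) (use fin in auto)
  have split: "{c. c \<noteq> {} \<and> c \<subseteq> I \<and> chain_subset c} = (P - {{}}) \<union> insert T ` P"
  proof (intro equalityI subsetI)
    fix c assume c: "c \<in> {c. c \<noteq> {} \<and> c \<subseteq> I \<and> chain_subset c}"
    show "c \<in> (P - {{}}) \<union> insert T ` P"
    proof (cases "T \<in> c")
      case True
      then have "c = insert T (c - {T})" by blast
      moreover have "c - {T} \<in> P" using c by (auto simp: P_def chain_subset_def)
      ultimately show ?thesis by blast
    qed (use c in \<open>auto simp: P_def\<close>)
  next
    fix c assume "c \<in> (P - {{}}) \<union> insert T ` P"
    then obtain d where d: "d \<subseteq> I - {T}" "chain_subset d" and c: "c = d \<and> d \<noteq> {} \<or> c = insert T d"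
      by (auto simp: P_def)
    have "\<forall>S\<in>d. S \<subseteq> T" using d T(2) by blast
    with d(2) have "chain_subset (insert T d)" unfolding chain_subset_def by blast
    with c d T(1) show "c \<in> {c. c \<noteq> {} \<and> c \<subseteq> I \<and> chain_subset c}" by blast
  qed
  have TP: "T \<notin> c" if "c \<in> P" for c using that by (auto simp: P_def)
  have card_ins: "card (insert T c) = Suc (card c)" if "c \<in> P" for c
    using TP[OF that] finite_subset[OF _ fin, of c] that by (simp add: P_def subset_Diff_insert)
  have "(\<Sum>c | c \<noteq> {} \<and> c \<subseteq> I \<and> chain_subset c. (-1) ^ (card c + 1))
    = (\<Sum>c\<in>P - {{}}. (-1) ^ (card c + 1)) + (\<Sum>c\<in>insert T ` P. (-1) ^ (card c + 1) :: int)"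
    unfolding split by (rule sum.union_disjoint) (use finP TP in auto)
  also have "(\<Sum>c\<in>insert T ` P. (-1) ^ (card c + 1)) = (\<Sum>c\<in>P. (-1) ^ card c :: int)"
  proof (subst sum.reindex)
    show "inj_on (insert T) P" using TP by (metis inj_onI insert_ident)
  qed (simp add: card_ins)
  also have "\<dots> = (-1) ^ card ({} :: 'a set set) + (\<Sum>c\<in>P - {{}}. (-1) ^ card c)"
    by (rule sum.remove[OF finP]) (simp add: P_def chain_subset_def)
  finally show ?thesis by (simp add: sum_negf)
qed

text \<open>
  The union of all invariant subsets is invariant. It is nonempty, since a nonempty subset of least
  cardinality that \<open>G\<close> maps into itself must be mapped onto itself.
\<close>

lemma largest_invariant_subset:
  assumes fin: "finite B" and ne: "B \<noteq> {}" and G: "G ` B \<subseteq> B"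
  shows "\<exists>T \<subseteq> B. T \<noteq> {} \<and> G ` T = T \<and> (\<forall>S \<subseteq> B. G ` S = S \<longrightarrow> S \<subseteq> T)"
proof -
  obtain S where S: "S \<subseteq> B \<and> S \<noteq> {} \<and> G ` S \<subseteq> S"
    and min: "\<And>S'. S' \<subseteq> B \<and> S' \<noteq> {} \<and> G ` S' \<subseteq> S' \<Longrightarrow> card S \<le> card S'"
    using ex_has_least_nat[of "\<lambda>S. S \<subseteq> B \<and> S \<noteq> {} \<and> G ` S \<subseteq> S" B card] assms by auto
  have "card S \<le> card (G ` S)" using S by (intro min) blast
  then have "G ` S = S"
    using S fin by (meson card_seteq finite_subset)
  let ?T = "\<Union>{S. S \<subseteq> B \<and> G ` S = S}"
  have "G ` ?T = \<Union>((`) G ` {S. S \<subseteq> B \<and> G ` S = S})" by (rule image_Union)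
  also have "(`) G ` {S. S \<subseteq> B \<and> G ` S = S} = (\<lambda>S. S) ` {S. S \<subseteq> B \<and> G ` S = S}"
    by (rule image_cong) auto
  finally have "G ` ?T = ?T" by simp
  moreover have "?T \<subseteq> B" by blast
  moreover have "?T \<noteq> {}" using S \<open>G ` S = S\<close> by blast
  ultimately show ?thesis by blast
qed

text \<open>
  \<open>G\<close> permutes the members of \<open>c\<close> and cannot increase cardinalities; as the sum of the cardinalities
  is preserved, each one is. Distinct members of a finite chain have distinct cardinalities, so the
  permutation is the identity.
\<close>

lemma invariant_chain_pointwise:
  assumes fin: "finite B" and c: "c \<subseteq> Pow B" "chain_subset c" and G: "(`) G ` c = c" and S: "S \<in> c"
  shows "G ` S = S"
proof -
  have finc: "finite c" using fin c(1) by (meson finite_Pow_iff finite_subset)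
  have finS: "finite S" if "S \<in> c" for S using that fin c(1) by (meson PowD finite_subset subsetD)
  have "inj_on ((`) G) c" using finc G by (simp add: finite_surj_inj)
  then have "(\<Sum>S\<in>c. card (G ` S)) = (\<Sum>S\<in>(`) G ` c. card S)"
    by (simp add: sum.reindex)
  then have "(\<Sum>S\<in>c. card (G ` S)) = (\<Sum>S\<in>c. card S)" unfolding G .
  then have "card (G ` S) = card S"
    by (rule sum_mono_inv) (use S finc finS card_image_le in auto)
  moreover have "G ` S \<subseteq> S \<or> S \<subseteq> G ` S"
    using c(2) S G unfolding chain_subset_def by blast
  ultimately show ?thesis
    using finS[OF S] by (metis card_subset_eq finite_imageI)
qed

text \<open>
  This is what counts every periodic point once: a self-map of a nonempty finite set may have many
  cycles, but the signed number of its invariant chains is always 1. Equivalently, the Lefschetz number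
  of the induced simplicial map of the barycentrically subdivided simplex on \<open>B\<close> is 1; chains of
  subsets are used rather than subsets since a chain that is mapped to itself is fixed memberwise, so
  that no signs of permutations appear.
\<close>

lemma sum_invariant_chains:
  assumes fin: "finite B" and ne: "B \<noteq> {}" and G: "G ` B \<subseteq> B"
  shows "(\<Sum>c | c \<noteq> {} \<and> c \<subseteq> Pow B - {{}} \<and> chain_subset c \<and> (`) G ` c = c. (-1) ^ (card c + 1)) = (1 :: int)"
proof -
  define I where "I = {S. S \<subseteq> B \<and> S \<noteq> {} \<and> G ` S = S}"
  obtain T where T: "T \<subseteq> B" "T \<noteq> {}" "G ` T = T" "\<And>S. S \<subseteq> B \<Longrightarrow> G ` S = S \<Longrightarrow> S \<subseteq> T"
    using largest_invariant_subset[OF assms] by blast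
  have "{c. c \<noteq> {} \<and> c \<subseteq> Pow B - {{}} \<and> chain_subset c \<and> (`) G ` c = c}
    = {c. c \<noteq> {} \<and> c \<subseteq> I \<and> chain_subset c}"
  proof (intro equalityI subsetI)
    fix c assume c: "c \<in> {c. c \<noteq> {} \<and> c \<subseteq> Pow B - {{}} \<and> chain_subset c \<and> (`) G ` c = c}"
    then have "G ` S = S" if "S \<in> c" for S
      using that by (intro invariant_chain_pointwise[OF fin, of c]) auto
    with c show "c \<in> {c. c \<noteq> {} \<and> c \<subseteq> I \<and> chain_subset c}" by (auto simp: I_def)
  next
    fix c assume c: "c \<in> {c. c \<noteq> {} \<and> c \<subseteq> I \<and> chain_subset c}"
    then have "(`) G ` c = (\<lambda>S. S) ` c" by (intro image_cong refl) (auto simp: I_def)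
    with c show "c \<in> {c. c \<noteq> {} \<and> c \<subseteq> Pow B - {{}} \<and> chain_subset c \<and> (`) G ` c = c}"
      by (auto simp: I_def)
  qed
  moreover have "finite I" unfolding I_def by (rule finite_subset[of _ "Pow B"]) (use fin in auto)
  moreover have "T \<in> I" "\<And>S. S \<in> I \<Longrightarrow> S \<subseteq> T" using T by (auto simp: I_def)
  ultimately show ?thesis
    using sum_nonempty_chains_with_top[of I T] by (simp only:)
qed

lemma chain_subset_image: "chain_subset c \<Longrightarrow> chain_subset ((`) h ` c)"
  unfolding chain_subset_def ball_simps by (meson image_mono)

section \<open>Counting periodic points by closed walks\<close>

text \<open>
  Applied twice, this turns a relation between chains that is stated in terms of arrows alone into the
  image under a map, on those chains that lie over a given point.
\<close>

lemma rel_set_converse_graph: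
  assumes "\<And>a b. a \<in> A \<Longrightarrow> b \<in> B \<Longrightarrow> R a b \<longleftrightarrow> a = h b" and "S \<subseteq> A" and "T \<subseteq> B"
  shows "rel_set R S T \<longleftrightarrow> S = h ` T"
  using assms unfolding rel_set_def by blast

text \<open>
  The combinatorial interface to the dynamics. Arrows \<open>\<rho> e e'\<close> are independent of the points of \<open>K\<close>;
  near any \<open>x\<close> they are the graph of a map \<open>B (f x) \<rightarrow> B x\<close>. In the assumption \<open>shadowing\<close>, every
  element of \<open>U i\<close> starts a path of arrows through \<open>U (i + 1)\<close>, \<open>U (i + 2)\<close> and so on; all these
  pseudo-orbits stay near each other and follow one periodic orbit.
\<close>

locale periodic_coding =
  fixes K :: "'a set" and f :: "'a \<Rightarrow> 'a"
    and E :: "'e set" and B :: "'a \<Rightarrow> 'e set" and \<rho> nearby :: "'e \<Rightarrow> 'e \<Rightarrow> bool"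
  assumes invariant_K: "x \<in> K \<Longrightarrow> f x \<in> K"
    and finite_E: "finite E"
    and B_subset: "x \<in> K \<Longrightarrow> B x \<subseteq> E"
    and B_nonempty: "x \<in> K \<Longrightarrow> B x \<noteq> {}"
    and pull_back: "x \<in> K \<Longrightarrow> e' \<in> B (f x) \<Longrightarrow> \<exists>!e. e \<in> B x \<and> \<rho> e e'"
    and B_near: "x \<in> K \<Longrightarrow> e \<in> B x \<Longrightarrow> e' \<in> B x \<Longrightarrow> nearby e e'"
    and shadowing: "\<And>n U. \<lbrakk>n > 0; \<And>i. U i \<noteq> {}; \<And>i. U i \<subseteq> E; \<And>i. U (i + n) = U i;
      \<And>i e e'. e \<in> U i \<Longrightarrow> e' \<in> U i \<Longrightarrow> nearby e e';
      \<And>i e. e \<in> U i \<Longrightarrow> \<exists>e'\<in>U (Suc i). \<rho> e e'\<rbrakk>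
      \<Longrightarrow> \<exists>!x. x \<in> K \<and> (f ^^ n) x = x \<and> (\<forall>i. U i \<subseteq> B ((f ^^ i) x))"
begin

text \<open>
  The vertices of the graph. The condition on \<open>nearby\<close> is the part of "contained in some \<open>B x\<close>" that
  can be expressed without mentioning a point \<open>x\<close>.
\<close>

definition simplices :: "'e set set set" where
  "simplices = {c. c \<noteq> {} \<and> c \<subseteq> Pow E - {{}} \<and> chain_subset c \<and> (\<forall>e\<in>\<Union>c. \<forall>e'\<in>\<Union>c. nearby e e')}"

abbreviation step :: "'e set set \<Rightarrow> 'e set set \<Rightarrow> bool" where
  "step \<equiv> rel_set (rel_set \<rho>)"

definition pull :: "'a \<Rightarrow> 'e \<Rightarrow> 'e" where
  "pull x e' = (THE e. e \<in> B x \<and> \<rho> e e')"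

text \<open>
  The composite \<open>B ((f ^^ k) x) \<rightarrow> B x\<close> of \<open>k\<close> pull-back maps along the orbit of \<open>x\<close>.
\<close>

primrec pull_iter :: "'a \<Rightarrow> nat \<Rightarrow> 'e \<Rightarrow> 'e" where
  "pull_iter x 0 = id"
| "pull_iter x (Suc k) = pull x \<circ> pull_iter (f x) k"

text \<open>
  The closed walks that lie over the orbit of \<open>x\<close>.
\<close>

definition codes :: "nat \<Rightarrow> 'a \<Rightarrow> (nat \<Rightarrow> 'e set set) set" where
  "codes n x = {w \<in> closed_walks simplices step n. \<forall>i. \<Union>(w i) \<subseteq> B ((f ^^ i) x)}"

lemma finite_simplices: "finite simplices"
  by (rule finite_subset[of _ "Pow (Pow E)"]) (auto simp: simplices_def finite_E)

lemma iter_in: "x \<in> K \<Longrightarrow> (f ^^ i) x \<in> K"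
  by (induction i) (auto simp: invariant_K)

lemma pull_eqI: "x \<in> K \<Longrightarrow> e' \<in> B (f x) \<Longrightarrow> e \<in> B x \<Longrightarrow> \<rho> e e' \<longleftrightarrow> e = pull x e'"
  unfolding pull_def using theI'[OF pull_back] pull_back by (metis (mono_tags, lifting))

lemma pull_in: "x \<in> K \<Longrightarrow> e' \<in> B (f x) \<Longrightarrow> pull x e' \<in> B x"
  unfolding pull_def using theI'[OF pull_back] by blast

lemma step_iff_pull:
  assumes x: "x \<in> K" and "\<Union>c \<subseteq> B x" and "\<Union>c' \<subseteq> B (f x)"
  shows "step c c' \<longleftrightarrow> c = (`) (pull x) ` c'"
proof (rule rel_set_converse_graph)
  fix S S' assume "S \<in> Pow (B x)" "S' \<in> Pow (B (f x))"
  then show "rel_set \<rho> S S' \<longleftrightarrow> S = pull x ` S'"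
    by (intro rel_set_converse_graph[of "B x" "B (f x)"]) (auto simp: pull_eqI x)
qed (use assms in auto)

lemma pull_iter_in: "x \<in> K \<Longrightarrow> e \<in> B ((f ^^ k) x) \<Longrightarrow> pull_iter x k e \<in> B x"
proof (induction k arbitrary: x)
  case (Suc k)
  then have "pull_iter (f x) k e \<in> B (f x)" by (simp add: invariant_K funpow_swap1)
  with Suc.prems show ?case by (simp add: pull_in)
qed simp

lemma code_step:
  assumes "x \<in> K" and w: "w \<in> codes n x"
  shows "w i = (`) (pull ((f ^^ i) x)) ` w (Suc i)"
proof -
  have "step (w i) (w (Suc i))" and sub: "\<Union>(w j) \<subseteq> B ((f ^^ j) x)" for j
    using w by (auto simp: codes_def closed_walks_def)
  then show ?thesis using step_iff_pull[OF iter_in[OF assms(1)], of "w i" i "w (Suc i)"] sub[of "Suc i"] by simp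
qed

lemma code_pull_iter:
  assumes "x \<in> K" and w: "w \<in> codes n x"
  shows "w i = (`) (pull_iter ((f ^^ i) x) k) ` w (i + k)"
proof (induction k arbitrary: i)
  case (Suc k)
  have "w i = (`) (pull ((f ^^ i) x)) ` w (Suc i)" by (rule code_step[OF assms])
  also have "\<dots> = (`) (pull ((f ^^ i) x)) ` (`) (pull_iter ((f ^^ Suc i) x) k) ` w (Suc i + k)"
    by (simp only: Suc[of "Suc i", symmetric])
  finally show ?case by (simp add: image_image image_comp comp_def)
qed simp

lemma code_period:
  assumes "w \<in> codes n x"
  shows "w (k * n) = w 0"
  using closed_walks_periodic[of w simplices step n 0 k] assms by (simp add: codes_def)

text \<open>
  Walking backwards is deterministic, so a periodic walk is recovered from its base point by pulling
  back from any later multiple of the period.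
\<close>

lemma code_determined:
  assumes x: "x \<in> K" and n: "n > 0" and w: "w \<in> codes n x"
  shows "w i = (`) (pull_iter ((f ^^ i) x) (i * n - i)) ` w 0"
proof -
  have "i + (i * n - i) = i * n" using n by simp
  then show ?thesis using code_pull_iter[OF x w, of i "i * n - i"] code_period[OF w, of i] by simp
qed

text \<open>
  Cardinalities cannot grow under pull-back, hence stay constant around a closed walk. The walks
  therefore split according to the parity that determines their sign.
\<close>

lemma card_code_constant:
  assumes x: "x \<in> K" and n: "n > 0" and w: "w \<in> codes n x"
  shows "card (w i) = card (w 0)"
proof (rule antisym)
  have "w j \<in> simplices" for j
    using w by (simp add: codes_def closed_walks_def)
  then have "w j \<subseteq> Pow E" for j
    unfolding simplices_def by blast
  then have fin: "finite (w j)" for j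
    using finite_E by (meson finite_Pow_iff finite_subset)
  show "card (w i) \<le> card (w 0)"
    by (subst code_determined[OF assms]) (rule card_image_le[OF fin])
  show "card (w 0) \<le> card (w i)"
    by (subst code_pull_iter[OF x w, of 0 i]) (simp add: card_image_le[OF fin])
qed

text \<open>
  Reading a closed walk once around its period shows that its base point is mapped to itself by the
  composite pull-back, and every chain with this property arises by pulling it back step by step.
\<close>

lemma bij_betw_codes:
  assumes x: "x \<in> K" and n: "n > 0" and per: "(f ^^ n) x = x"
  shows "bij_betw (\<lambda>w. w 0) (codes n x)
    {c. c \<noteq> {} \<and> c \<subseteq> Pow (B x) - {{}} \<and> chain_subset c \<and> (`) (pull_iter x n) ` c = c}"
    (is "bij_betw _ _ ?C")
proof (rule bij_betw_imageI)
  show "inj_on (\<lambda>w. w 0) (codes n x)"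
  proof (rule inj_onI, rule ext)
    fix w w' i assume "w \<in> codes n x" "w' \<in> codes n x" "w 0 = w' 0"
    then show "w i = w' i" using code_determined[OF x n] by metis
  qed
  have "w 0 \<in> ?C" if w: "w \<in> codes n x" for w
  proof -
    have "w 0 = (`) (pull_iter x n) ` w 0"
      using code_pull_iter[OF x w, of 0 n] code_period[OF w, of 1] by simp
    moreover have "\<Union>(w 0) \<subseteq> B ((f ^^ 0) x)" "w 0 \<in> simplices"
      using w unfolding codes_def closed_walks_def by blast+
    ultimately show ?thesis by (auto simp: simplices_def)
  qed
  moreover have "c \<in> (\<lambda>w. w 0) ` codes n x" if c: "c \<in> ?C" for c
  proof -
    \<comment> \<open>Position \<open>i\<close> is reached from the end of its period by \<open>n - i mod n\<close> steps backwards.\<close>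
    define w where "w i = (`) (pull_iter ((f ^^ (i mod n)) x) (n - i mod n)) ` c" for i
    have w0: "w 0 = c" using c by (simp add: w_def)
    have iter_mod: "(f ^^ (i mod n)) x = (f ^^ i) x" for i
      using per by (metis funpow_mod_eq)
    have in_B: "pull_iter ((f ^^ (i mod n)) x) (n - i mod n) e \<in> B ((f ^^ i) x)" if "e \<in> B x" for i e
    proof -
      have "(f ^^ (n - i mod n)) ((f ^^ (i mod n)) x) = (f ^^ n) x"
        using n by (simp add: funpow_add[symmetric, unfolded comp_def, THEN fun_cong] less_imp_le)
      then show ?thesis
        using pull_iter_in[OF iter_in[OF x], of e "n - i mod n" "i mod n"] that iter_mod[of i] per by simp
    qed
    have sub: "\<Union>(w i) \<subseteq> B ((f ^^ i) x)" for i
      using c in_B[of _ i] by (auto simp: w_def)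
    have "w i \<in> simplices" for i
    proof -
      have "B ((f ^^ i) x) \<subseteq> E" by (rule B_subset[OF iter_in[OF x]])
      then have "w i \<subseteq> Pow E - {{}}" using sub[of i] c by (auto simp: w_def)
      moreover have "chain_subset (w i)"
        using c unfolding w_def by (intro chain_subset_image) simp
      moreover have "w i \<noteq> {}" using c by (simp add: w_def)
      moreover have "\<forall>e\<in>\<Union>(w i). \<forall>e'\<in>\<Union>(w i). nearby e e'"
        using B_near[OF iter_in[OF x]] sub[of i] by (meson subsetD)
      ultimately show ?thesis unfolding simplices_def by (intro CollectI conjI)
    qed
    moreover have "step (w i) (w (Suc i))" for i
    proof -
      have "n - i mod n = Suc (n - Suc (i mod n))" using n by (simp add: Suc_diff_Suc)
      then have "w i = (`) (pull ((f ^^ i) x)) ` (`) (pull_iter (f ((f ^^ (i mod n)) x)) (n - Suc (i mod n))) ` c"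
        by (simp add: w_def image_image image_comp comp_def iter_mod)
      also have "(`) (pull_iter (f ((f ^^ (i mod n)) x)) (n - Suc (i mod n))) ` c = w (Suc i)"
      proof (cases "Suc (i mod n) = n")
        case True
        then have "Suc i mod n = 0" by (simp add: mod_Suc)
        then show ?thesis using True c by (simp add: w_def)
      next
        case False
        then show ?thesis by (simp add: w_def mod_Suc)
      qed
      finally show ?thesis using step_iff_pull[OF iter_in[OF x] sub[of i], of "w (Suc i)"] sub[of "Suc i"] by simp
    qed
    moreover have "w (i + n) = w i" for i by (simp add: w_def)
    ultimately have "w \<in> codes n x" using sub by (simp add: codes_def closed_walks_def)
    then show ?thesis using w0 by blast
  qed
  ultimately show "(\<lambda>w. w 0) ` codes n x = ?C"
    by (intro equalityI image_subsetI subsetI)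
qed

lemma sum_codes:
  assumes x: "x \<in> K" and n: "n > 0" and per: "(f ^^ n) x = x"
  shows "(\<Sum>w\<in>codes n x. (-1) ^ (card (w 0) + 1)) = (1 :: int)"
proof -
  have "pull_iter x n ` B x \<subseteq> B x" using pull_iter_in[OF x] per by auto
  moreover have "finite (B x)" using B_subset[OF x] finite_E finite_subset by blast
  ultimately show ?thesis
    using sum_invariant_chains[OF _ B_nonempty[OF x]]
      sum.reindex_bij_betw[OF bij_betw_codes[OF assms], of "\<lambda>c. (-1) ^ (card c + 1) :: int"]
    by simp
qed

lemma ex1_coded_point:
  assumes n: "n > 0" and w: "w \<in> closed_walks simplices step n"
  shows "\<exists>!x. x \<in> K \<and> (f ^^ n) x = x \<and> w \<in> codes n x"
proof -
  have w': "w i \<in> simplices" "step (w i) (w (Suc i))" "w (i + n) = w i" for i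
    using w by (auto simp: closed_walks_def)
  have "\<exists>!x. x \<in> K \<and> (f ^^ n) x = x \<and> (\<forall>i. \<Union>(w i) \<subseteq> B ((f ^^ i) x))"
  proof (rule shadowing[OF n, where U = "\<lambda>i. \<Union>(w i)"])
    fix i e assume "e \<in> \<Union>(w i)"
    then obtain S where "S \<in> w i" "e \<in> S" by blast
    moreover from rel_setD1[OF w'(2) this(1)] obtain S' where "S' \<in> w (Suc i)" "rel_set \<rho> S S'" by blast
    ultimately show "\<exists>e'\<in>\<Union>(w (Suc i)). \<rho> e e'"
      by (meson UnionI rel_setD1)
  next
    fix i show "\<Union>(w i) \<noteq> {}" using w'(1)[of i] unfolding simplices_def by blast
  next
    fix i show "\<Union>(w i) \<subseteq> E" using w'(1)[of i] unfolding simplices_def by blast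
  next
    fix i show "\<Union>(w (i + n)) = \<Union>(w i)" using w'(3) by simp
  next
    fix i e e' assume "e \<in> \<Union>(w i)" "e' \<in> \<Union>(w i)"
    then show "nearby e e'" using w'(1)[of i] unfolding simplices_def by blast
  qed
  with w show ?thesis by (simp add: codes_def)
qed

text \<open>
  Grouping the closed walks by the periodic point that they follow, each group contributes 1.
\<close>

lemma sum_closed_walks:
  assumes n: "n > 0"
  shows "(\<Sum>w\<in>closed_walks simplices step n. (-1) ^ (card (w 0) + 1)) = int (num_fixpoints K f n)"
proof -
  let ?W = "closed_walks simplices step n" and ?F = "{x \<in> K. (f ^^ n) x = x}"
  define pt where "pt w = (THE x. x \<in> K \<and> (f ^^ n) x = x \<and> w \<in> codes n x)" for w
  have pt: "pt w \<in> ?F" "w \<in> codes n (pt w)" if "w \<in> ?W" for w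
    using theI'[OF ex1_coded_point[OF n that]] unfolding pt_def by auto
  have fibre: "{w \<in> ?W. pt w = x} = codes n x" if x: "x \<in> ?F" for x
  proof (intro equalityI subsetI)
    fix w assume w: "w \<in> codes n x"
    then have W: "w \<in> ?W" by (simp add: codes_def)
    then have "pt w = x"
      unfolding pt_def using x w by (intro the1_equality[OF ex1_coded_point[OF n]]) auto
    with W show "w \<in> {w \<in> ?W. pt w = x}" by simp
  qed (use pt in blast)
  have "codes n x \<noteq> {}" if "x \<in> ?F" for x
    using sum_codes[of x n] n that by auto
  then have "x \<in> pt ` ?W" if "x \<in> ?F" for x
    using fibre[OF that] that by (metis (mono_tags, lifting) empty_Collect_eq imageI)
  with pt(1) have img: "pt ` ?W = ?F" by (intro equalityI image_subsetI subsetI)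
  have fin: "finite ?W" by (rule finite_closed_walks[OF finite_simplices n])
  have "(\<Sum>w\<in>?W. (-1) ^ (card (w 0) + 1))
    = (\<Sum>x\<in>pt ` ?W. \<Sum>w | w \<in> ?W \<and> pt w = x. (-1) ^ (card (w 0) + 1) :: int)"
    by (rule sum.image_gen[OF fin])
  also have "\<dots> = (\<Sum>x\<in>?F. 1)"
    unfolding img
  proof (rule sum.cong[OF refl])
    fix x assume x: "x \<in> ?F"
    show "(\<Sum>w | w \<in> ?W \<and> pt w = x. (-1) ^ (card (w 0) + 1)) = (1 :: int)"
      unfolding fibre[OF x] using x by (intro sum_codes[OF _ n]) auto
  qed
  finally show ?thesis by (simp add: num_fixpoints_def)
qed

text \<open>
  By constancy of the cardinality, restricting the vertices of a walk is the same as restricting its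
  base point, so the signed count becomes a difference of counts in two graphs.
\<close>

lemma closed_walks_parity:
  assumes n: "n > 0"
  shows "closed_walks {c \<in> simplices. P (card c)} step n = {w \<in> closed_walks simplices step n. P (card (w 0))}"
proof -
  have "card (w i) = card (w 0)" if W: "w \<in> closed_walks simplices step n" for w i
  proof -
    obtain x where "x \<in> K" "w \<in> codes n x" using ex1_implies_ex[OF ex1_coded_point[OF n W]] by auto
    then show ?thesis by (intro card_code_constant[OF _ n])
  qed
  then show ?thesis by (simp add: closed_walks_def set_eq_iff) metis
qed

theorem num_fixpoints_eq_diff:
  assumes n: "n > 0"
  shows "int (num_fixpoints K f n) =
    int (card (closed_walks {c \<in> simplices. odd (card c)} step n))
    - int (card (closed_walks {c \<in> simplices. even (card c)} step n))"
proof -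
  let ?W = "closed_walks simplices step n"
  have fin: "finite ?W" by (rule finite_closed_walks[OF finite_simplices n])
  have "(\<Sum>w\<in>?W. (-1) ^ (card (w 0) + 1) :: int)
    = (\<Sum>w\<in>?W. of_bool (odd (card (w 0))) - of_bool (even (card (w 0))))"
    by (intro sum.cong[OF refl]) simp
  also have "\<dots> = int (card {w \<in> ?W. odd (card (w 0))}) - int (card {w \<in> ?W. even (card (w 0))})"
    using fin by (simp add: sum_subtractf Int_def)
  finally show ?thesis
    using sum_closed_walks[OF n] closed_walks_parity[OF n, of odd] closed_walks_parity[OF n, of even] by simp
qed

end

section \<open>Expansivity, shadowing and the coding\<close>

text \<open>
  The inverse branches enter only through single points: \<open>lift\<close> is the value at \<open>y\<close> of the branch
  that sends \<open>f a\<close> to \<open>a\<close>.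
\<close>

locale ruelle_expanding =
  fixes K :: "'a::metric_space set" and f :: "'a \<Rightarrow> 'a" and r lam c :: real
  assumes compact_K: "compact K" and f_in: "x \<in> K \<Longrightarrow> f x \<in> K" and cont: "continuous_on K f"
    and r: "r > 0" and lam: "0 < lam" "lam < 1" and c: "c > 0"
    and sep: "\<lbrakk>x \<in> K; y \<in> K; f x = f y; dist x y \<le> c\<rbrakk> \<Longrightarrow> x = y"
    and lift: "\<lbrakk>a \<in> K; y \<in> K; dist (f a) y < r\<rbrakk>
      \<Longrightarrow> \<exists>b\<in>K. f b = y \<and> dist b a \<le> lam * dist y (f a)"
begin

lemma funpow_in: "x \<in> K \<Longrightarrow> (f ^^ i) x \<in> K"
  by (induction i) (auto simp: f_in)

lemma continuous_on_funpow: "continuous_on K (f ^^ i)"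
proof (induction i)
  case (Suc i)
  then show ?case
    unfolding funpow.simps by (rule continuous_on_compose) (rule continuous_on_subset[OF cont], auto simp: funpow_in)
qed simp

lemma finite_net:
  assumes "\<delta> > 0"
  obtains X where "finite X" "X \<subseteq> K" "\<And>x. x \<in> K \<Longrightarrow> \<exists>s\<in>X. dist x s < \<delta>"
proof -
  obtain X where "finite X" "X \<subseteq> K" "K \<subseteq> (\<Union>s\<in>X. ball s \<delta>)"
    using seq_compact_imp_totally_bounded[OF compact_imp_seq_compact[OF compact_K], rule_format, OF assms]
    by (elim exE conjE) (rule that)
  moreover have "\<exists>s\<in>X. dist x s < \<delta>" if "x \<in> K" for x
    using subsetD[OF \<open>K \<subseteq> _\<close> that] by (auto simp: dist_commute)
  ultimately show thesis by (intro that[of X])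
qed

text \<open>
  Distinct points with the same image are more than \<open>c\<close> apart, so a point of the preimage is determined by its image and
  by a point of a net of mesh \<open>c / 2\<close> close to it.
\<close>

lemma finite_preimage:
  assumes X: "finite X"
  shows "finite {e \<in> K. f e \<in> X}"
proof -
  obtain Y where Y: "finite Y" "\<And>x. x \<in> K \<Longrightarrow> \<exists>s\<in>Y. dist x s < c / 2"
    using finite_net[of "c / 2"] c by (metis half_gt_zero)
  then obtain \<beta> where \<beta>: "\<And>x. x \<in> K \<Longrightarrow> \<beta> x \<in> Y \<and> dist x (\<beta> x) < c / 2" by metis
  have "inj_on (\<lambda>e. (f e, \<beta> e)) {e \<in> K. f e \<in> X}"
  proof (rule inj_onI)
    fix e e' assume e: "e \<in> {e \<in> K. f e \<in> X}" "e' \<in> {e \<in> K. f e \<in> X}" and eq: "(f e, \<beta> e) = (f e', \<beta> e')"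
    have "dist e e' \<le> dist e (\<beta> e) + dist e' (\<beta> e)" by (rule dist_triangle2)
    also have "\<dots> \<le> c" using \<beta>[of e] \<beta>[of e'] e eq by auto
    finally show "e = e'" using sep[of e e'] e eq by auto
  qed
  moreover have "(\<lambda>e. (f e, \<beta> e)) ` {e \<in> K. f e \<in> X} \<subseteq> X \<times> Y" using \<beta> by auto
  ultimately show ?thesis
    using X Y(1) by (meson finite_SigmaI inj_on_finite)
qed

text \<open>
  If \<open>x\<close> and \<open>y\<close> are close, the lift of \<open>f y\<close> near \<open>x\<close> is a point with the same image as \<open>y\<close> and
  close to it, hence equal to \<open>y\<close>.
\<close>

lemma locally_expanding:
  obtains \<eta> where "\<eta> > 0" "\<And>x y. \<lbrakk>x \<in> K; y \<in> K; dist x y < \<eta>\<rbrakk> \<Longrightarrow> dist x y \<le> lam * dist (f x) (f y)"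
proof -
  obtain d where d: "d > 0" "\<And>x y. \<lbrakk>x \<in> K; y \<in> K; dist x y < d\<rbrakk> \<Longrightarrow> dist (f x) (f y) < min r (c / 2)"
    using compact_uniformly_continuous[OF cont compact_K] r c unfolding uniformly_continuous_on_def
    by (metis half_gt_zero min_less_iff_conj)
  show thesis
  proof (rule that[of "min d (c / 2)"])
    fix x y assume x: "x \<in> K" and y: "y \<in> K" and xy: "dist x y < min d (c / 2)"
    then have fxy: "dist (f x) (f y) < r" "dist (f x) (f y) < c / 2" using d(2)[OF x y] by auto
    obtain b where b: "b \<in> K" "f b = f y" "dist b x \<le> lam * dist (f y) (f x)"
      using lift[OF x f_in[OF y] fxy(1)] by blast
    have "lam * dist (f y) (f x) \<le> 1 * dist (f y) (f x)" using lam by (intro mult_right_mono) auto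
    then have "dist b x \<le> c / 2" using b(3) fxy(2) by (simp add: dist_commute)
    moreover have "dist b y \<le> dist b x + dist x y" by (rule dist_triangle)
    ultimately have "b = y" using sep[OF b(1) y b(2)] xy by auto
    with b(3) show "dist x y \<le> lam * dist (f x) (f y)" by (simp add: dist_commute)
  qed (use d c in auto)
qed

lemma expansive:
  obtains \<eta> where "\<eta> > 0"
    "\<And>x y. \<lbrakk>x \<in> K; y \<in> K; \<And>i. dist ((f ^^ i) x) ((f ^^ i) y) < \<eta>\<rbrakk> \<Longrightarrow> x = y"
proof -
  obtain \<eta> where \<eta>: "\<eta> > 0" "\<And>x y. \<lbrakk>x \<in> K; y \<in> K; dist x y < \<eta>\<rbrakk> \<Longrightarrow> dist x y \<le> lam * dist (f x) (f y)"
    using locally_expanding by blast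
  have "x = y" if x: "x \<in> K" and y: "y \<in> K" and near: "\<And>i. dist ((f ^^ i) x) ((f ^^ i) y) < \<eta>" for x y
  proof (rule ccontr)
    assume "x \<noteq> y"
    then obtain m where m: "lam ^ m < dist x y / \<eta>"
      using real_arch_pow_inv[OF _ lam(2), of "dist x y / \<eta>"] \<eta>(1) by auto
    have "dist x y \<le> lam ^ i * dist ((f ^^ i) x) ((f ^^ i) y)" for i
    proof (induction i)
      case (Suc i)
      have "dist ((f ^^ i) x) ((f ^^ i) y) \<le> lam * dist ((f ^^ Suc i) x) ((f ^^ Suc i) y)"
        using \<eta>(2)[OF funpow_in[OF x] funpow_in[OF y] near] by simp
      then have "lam ^ i * dist ((f ^^ i) x) ((f ^^ i) y)
          \<le> lam ^ i * (lam * dist ((f ^^ Suc i) x) ((f ^^ Suc i) y))"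
        using lam by (intro mult_left_mono) auto
      with Suc show ?case by (simp add: mult_ac)
    qed simp
    note this[of m]
    also have "lam ^ m * dist ((f ^^ m) x) ((f ^^ m) y) \<le> lam ^ m * \<eta>"
      using near[of m] lam by (intro mult_left_mono) auto
    finally have "dist x y \<le> lam ^ m * \<eta>" .
    with m \<eta>(1) show False by (simp add: field_simps)
  qed
  with \<eta>(1) show thesis by (rule that)
qed

text \<open>
  The shadowing point is built from the far end: an orbit segment that follows \<open>e 1, e 2, \<dots>\<close> up to
  \<open>\<rho>\<close> is prolonged backwards by the lift near \<open>e 0\<close>. The jump \<open>\<delta>\<close> and the error \<open>\<rho>\<close> add up, and
  contraction brings the sum back to \<open>\<rho>\<close>.
\<close>

lemma finite_shadowing:
  assumes "0 \<le> \<rho>" and "lam * (\<delta> + \<rho>) \<le> \<rho>" and "\<delta> + \<rho> \<le> r"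
    and "\<And>i. e i \<in> K" and "\<And>i. dist (f (e i)) (e (Suc i)) < \<delta>"
  shows "\<exists>x\<in>K. \<forall>i\<le>N. dist ((f ^^ i) x) (e i) \<le> \<rho>"
  using assms(4,5)
proof (induction N arbitrary: e)
  case 0
  then show ?case using assms(1) by (intro bexI[of _ "e 0"]) auto
next
  case (Suc N)
  from Suc.IH[of "\<lambda>i. e (Suc i)"] Suc.prems obtain y
    where y: "y \<in> K" "\<And>i. i \<le> N \<Longrightarrow> dist ((f ^^ i) y) (e (Suc i)) \<le> \<rho>" by auto
  have "dist (f (e 0)) y \<le> dist (f (e 0)) (e (Suc 0)) + dist y (e (Suc 0))" by (rule dist_triangle2)
  then have close: "dist (f (e 0)) y < \<delta> + \<rho>" using Suc.prems(2)[of 0] y(2)[of 0] by simp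
  then obtain b where b: "b \<in> K" "f b = y" "dist b (e 0) \<le> lam * dist y (f (e 0))"
    using lift[OF Suc.prems(1) y(1), of 0] assms(3) by auto
  have "lam * dist y (f (e 0)) \<le> lam * (\<delta> + \<rho>)"
    using close lam by (intro mult_left_mono) (auto simp: dist_commute)
  with b(3) assms(2) have "dist b (e 0) \<le> \<rho>" by linarith
  then have "dist ((f ^^ i) b) (e i) \<le> \<rho>" if "i \<le> Suc N" for i
    using that y(2) b(2) by (cases i) (auto simp: funpow_swap1)
  with b(1) show ?case by blast
qed

lemma shadowing:
  assumes "0 \<le> \<rho>" and "lam * (\<delta> + \<rho>) \<le> \<rho>" and "\<delta> + \<rho> \<le> r"
    and "\<And>i. e i \<in> K" and "\<And>i. dist (f (e i)) (e (Suc i)) < \<delta>"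
  shows "\<exists>x\<in>K. \<forall>i. dist ((f ^^ i) x) (e i) \<le> \<rho>"
proof -
  have "\<forall>N. \<exists>x\<in>K. \<forall>i\<le>N. dist ((f ^^ i) x) (e i) \<le> \<rho>"
    using finite_shadowing[OF assms(1-3), of e] assms(4,5) by blast
  then obtain X where X: "\<And>N. X N \<in> K" "\<And>N i. i \<le> N \<Longrightarrow> dist ((f ^^ i) (X N)) (e i) \<le> \<rho>"
    by metis
  obtain x s where x: "x \<in> K" and s: "strict_mono s" and lim: "(X \<circ> s) \<longlonglongrightarrow> x"
    using seq_compactE[OF compact_imp_seq_compact[OF compact_K], of X] X(1) by blast
  have "dist ((f ^^ i) x) (e i) \<le> \<rho>" for i
  proof (rule tendsto_upperbound)
    have "\<forall>\<^sub>F n in sequentially. (X \<circ> s) n \<in> K" using X(1) by simp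
    then have "(\<lambda>n. (f ^^ i) ((X \<circ> s) n)) \<longlonglongrightarrow> (f ^^ i) x"
      by (rule continuous_on_tendsto_compose[OF continuous_on_funpow lim x])
    then show "(\<lambda>n. dist ((f ^^ i) ((X \<circ> s) n)) (e i)) \<longlonglongrightarrow> dist ((f ^^ i) x) (e i)"
      by (intro tendsto_intros)
    show "\<forall>\<^sub>F n in sequentially. dist ((f ^^ i) ((X \<circ> s) n)) (e i) \<le> \<rho>"
      using eventually_ge_at_top[of i]
    proof eventually_elim
      case (elim n)
      then show ?case using X(2)[of i "s n"] strict_mono_imp_increasing[OF s, of n] by simp
    qed
  qed simp
  with x show ?thesis by blast
qed

text \<open>
  The scale \<open>\<epsilon>\<close> is chosen so that points within \<open>2 * \<epsilon>\<close> lie in the range of a lift and are separated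
  if they have the same image, and orbits that remain within \<open>4 * \<epsilon>\<close> coincide. The mesh
  \<open>\<delta> = \<epsilon> * (1 - lam)\<close> makes the pull-back map \<open>B (f x)\<close> into \<open>B x\<close>, because
  \<open>lam * (\<epsilon> + \<delta>) < \<epsilon>\<close>, and allows shadowing with error \<open>lam * \<epsilon>\<close>, because
  \<open>lam * (\<delta> + lam * \<epsilon>) = lam * \<epsilon>\<close>.
\<close>

theorem exists_periodic_coding:
  "\<exists>(E :: 'a set) B \<rho> nearby. periodic_coding K f E B \<rho> nearby"
proof -
  obtain \<eta> where \<eta>: "\<eta> > 0"
    "\<And>x y. \<lbrakk>x \<in> K; y \<in> K; \<And>i. dist ((f ^^ i) x) ((f ^^ i) y) < \<eta>\<rbrakk> \<Longrightarrow> x = y"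
    using expansive by blast
  define \<epsilon> where "\<epsilon> = min (r / 2) (min (c / 2) (\<eta> / 4))"
  have \<epsilon>: "\<epsilon> > 0" "2 * \<epsilon> \<le> r" "2 * \<epsilon> \<le> c" "4 * \<epsilon> \<le> \<eta>"
    using r c \<eta>(1) by (auto simp: \<epsilon>_def)
  define \<delta> where "\<delta> = \<epsilon> * (1 - lam)"
  have \<delta>: "0 < \<delta>" "\<delta> < \<epsilon>"
    using \<epsilon>(1) lam by (auto simp: \<delta>_def)
  have "lam * (\<epsilon> + \<delta>) = \<epsilon> - \<epsilon> * (1 - lam)\<^sup>2"
    by (simp add: \<delta>_def power2_eq_square algebra_simps)
  then have contr: "lam * (\<epsilon> + \<delta>) < \<epsilon>" using \<epsilon>(1) lam by simp
  obtain X where X: "finite X" "X \<subseteq> K" "\<And>x. x \<in> K \<Longrightarrow> \<exists>s\<in>X. dist x s < \<delta>"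
    using finite_net[OF \<delta>(1)] by blast
  then obtain \<alpha> where \<alpha>: "\<And>x. x \<in> K \<Longrightarrow> \<alpha> x \<in> X \<and> dist x (\<alpha> x) < \<delta>" by metis
  define E where "E = {e \<in> K. f e \<in> X}"
  define B where "B x = {e \<in> E. dist e x < \<epsilon>}" for x
  define arrow where "arrow e e' \<longleftrightarrow> f e = \<alpha> e'" for e e'
  have lift_net: "\<exists>b\<in>B x. f b = s" if x: "x \<in> K" and s: "s \<in> X" and d: "dist (f x) s < \<epsilon> + \<delta>" for x s
  proof -
    have "s \<in> K" using s X(2) by blast
    then obtain b where b: "b \<in> K" "f b = s" "dist b x \<le> lam * dist s (f x)"
      using lift[OF x, of s] d \<delta> \<epsilon> by auto
    have "lam * dist s (f x) \<le> lam * (\<epsilon> + \<delta>)"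
      using d lam by (intro mult_left_mono) (auto simp: dist_commute)
    with b contr have "dist b x < \<epsilon>" by linarith
    then show ?thesis using b s by (auto simp: B_def E_def)
  qed
  have "periodic_coding K f E B arrow (\<lambda>e e'. dist e e' < 2 * \<epsilon>)"
  proof
    fix x e' assume x: "x \<in> K" and e': "e' \<in> B (f x)"
    then have "e' \<in> K" "dist e' (f x) < \<epsilon>" by (auto simp: B_def E_def)
    then have "dist (f x) (\<alpha> e') < \<epsilon> + \<delta>"
      using dist_triangle3[of "f x" "\<alpha> e'" e'] \<alpha>[of e'] by auto
    then obtain b where "b \<in> B x" "f b = \<alpha> e'" using lift_net[OF x] \<alpha>[OF \<open>e' \<in> K\<close>] by blast
    moreover have "b1 = b2" if b: "b1 \<in> B x" "b2 \<in> B x" "f b1 = f b2" for b1 b2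
    proof (rule sep)
      have "dist b1 b2 \<le> dist b1 x + dist b2 x" by (rule dist_triangle2)
      with b \<epsilon> show "dist b1 b2 \<le> c" by (auto simp: B_def)
    qed (use b in \<open>auto simp: B_def E_def\<close>)
    ultimately show "\<exists>!e. e \<in> B x \<and> arrow e e'"
      unfolding arrow_def by (metis (no_types, lifting))
  next
    fix x assume x: "x \<in> K"
    obtain s where "s \<in> X" "dist (f x) s < \<delta>" using X(3)[OF f_in[OF x]] by blast
    then show "B x \<noteq> {}" using lift_net[OF x, of s] \<epsilon> by force
  next
    fix x e e' assume "e \<in> B x" "e' \<in> B x"
    then show "dist e e' < 2 * \<epsilon>"
      using dist_triangle2[of e e' x] by (simp add: B_def)
  next
    fix n :: nat and U :: "nat \<Rightarrow> 'a set"
    assume n: "n > 0" and ne: "\<And>i. U i \<noteq> {}" and UE: "\<And>i. U i \<subseteq> E" and per: "\<And>i. U (i + n) = U i"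
      and small: "\<And>i e e'. e \<in> U i \<Longrightarrow> e' \<in> U i \<Longrightarrow> dist e e' < 2 * \<epsilon>"
      and succ: "\<And>i e. e \<in> U i \<Longrightarrow> \<exists>e'\<in>U (Suc i). arrow e e'"
    \<comment> \<open>A point follows \<open>U\<close> from time \<open>i\<close> on if its orbit stays close to some elements of these sets, which need not form a path.\<close>
    define tracks where "tracks y i \<longleftrightarrow> y \<in> K \<and> (\<forall>j. \<exists>e\<in>U (i + j). dist ((f ^^ j) y) e < \<epsilon>)" for y i
    \<comment> \<open>Two elements of the same \<open>U k\<close> are within \<open>2 * \<epsilon>\<close>, so two such orbits stay within \<open>4 * \<epsilon>\<close>.\<close>
    have tracks_unique: "y = z" if y: "tracks y i" and z: "tracks z i" for y z i
    proof (rule \<eta>(2))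
      fix j
      obtain e e' where e: "e \<in> U (i + j)" "dist ((f ^^ j) y) e < \<epsilon>"
        and e': "e' \<in> U (i + j)" "dist ((f ^^ j) z) e' < \<epsilon>"
        using y z unfolding tracks_def by blast
      have "dist ((f ^^ j) y) ((f ^^ j) z) \<le> dist ((f ^^ j) y) e + dist e ((f ^^ j) z)"
        by (rule dist_triangle)
      also have "dist e ((f ^^ j) z) \<le> dist e e' + dist ((f ^^ j) z) e'"
        by (rule dist_triangle2)
      finally show "dist ((f ^^ j) y) ((f ^^ j) z) < \<eta>"
        using e(2) e'(2) small[OF e(1) e'(1)] \<epsilon>(4) by linarith
    qed (use y z in \<open>auto simp: tracks_def\<close>)
    have tracks_funpow: "tracks ((f ^^ k) x) (i + k)" if "tracks x i" for x i k
      unfolding tracks_def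
    proof (intro conjI allI)
      show "(f ^^ k) x \<in> K" using that funpow_in by (simp add: tracks_def)
      fix j
      have "(f ^^ j) ((f ^^ k) x) = (f ^^ (k + j)) x" by (simp add: funpow_add add.commute[of k])
      then show "\<exists>e\<in>U (i + k + j). dist ((f ^^ j) ((f ^^ k) x)) e < \<epsilon>"
        using that unfolding tracks_def by (metis add.assoc)
    qed
    have tracks_exists: "\<exists>y. tracks y i \<and> dist y e < \<epsilon>" if "e \<in> U i" for e i
    proof -
      have "\<exists>w. \<forall>j. (w j \<in> U (i + j) \<and> (j = 0 \<longrightarrow> w j = e)) \<and> arrow (w j) (w (Suc j))"
        by (rule dependent_nat_choice) (use that succ in auto)
      then obtain w where w: "\<And>j. w j \<in> U (i + j)" "w 0 = e" "\<And>j. arrow (w j) (w (Suc j))" by metis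
      have "\<exists>y\<in>K. \<forall>j. dist ((f ^^ j) y) (w j) \<le> lam * \<epsilon>"
      proof (rule shadowing)
        show "lam * (\<delta> + lam * \<epsilon>) \<le> lam * \<epsilon>" by (simp add: \<delta>_def algebra_simps)
        have "lam * \<epsilon> \<le> \<epsilon>" using lam \<epsilon>(1) by simp
        then show "\<delta> + lam * \<epsilon> \<le> r" using \<delta> \<epsilon> by linarith
        show wK: "w j \<in> K" for j using w(1)[of j] UE by (auto simp: E_def)
        show "dist (f (w j)) (w (Suc j)) < \<delta>" for j
          using w(3)[of j] \<alpha>[OF wK, of "Suc j"] by (simp add: arrow_def dist_commute)
      qed (use lam \<epsilon>(1) in simp)
      then obtain y where "y \<in> K" "\<And>j. dist ((f ^^ j) y) (w j) \<le> lam * \<epsilon>" by blast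
      moreover have "lam * \<epsilon> < \<epsilon>" using lam \<epsilon>(1) by simp
      ultimately have "y \<in> K" and close: "\<And>j. dist ((f ^^ j) y) (w j) < \<epsilon>" by (auto intro: le_less_trans)
      then show ?thesis using w(1) close[of 0] w(2) unfolding tracks_def by auto
    qed
    obtain x where x: "tracks x 0" using tracks_exists[of _ 0] ne[of 0] by blast
    show "\<exists>!x. x \<in> K \<and> (f ^^ n) x = x \<and> (\<forall>i. U i \<subseteq> B ((f ^^ i) x))"
    proof (rule ex1I[of _ x], intro conjI allI subsetI)
      show "x \<in> K" using x by (simp add: tracks_def)
      have "tracks ((f ^^ n) x) n" using tracks_funpow[OF x, of n] by simp
      then have "tracks ((f ^^ n) x) 0" using per by (simp add: tracks_def add.commute[of n])
      then show "(f ^^ n) x = x" using x by (rule tracks_unique)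
      \<comment> \<open>The orbit that starts close to this particular \<open>e\<close> is the orbit of \<open>x\<close>, by uniqueness.\<close>
      fix i e assume e: "e \<in> U i"
      then obtain y where y: "tracks y i" "dist y e < \<epsilon>" using tracks_exists by blast
      then have "y = (f ^^ i) x" using tracks_unique tracks_funpow[OF x, of i] by simp
      then show "e \<in> B ((f ^^ i) x)" using y(2) UE e by (auto simp: B_def dist_commute)
    next
      fix x' assume x': "x' \<in> K \<and> (f ^^ n) x' = x' \<and> (\<forall>i. U i \<subseteq> B ((f ^^ i) x'))"
      have "\<exists>e\<in>U i. dist ((f ^^ i) x') e < \<epsilon>" for i
        using ne[of i] x' by (auto simp: B_def dist_commute subset_iff)
      then have "tracks x' 0" using x' by (simp add: tracks_def)
      then show "x' = x" using x by (rule tracks_unique)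
    qed
  qed (auto simp: f_in B_def E_def finite_preimage[OF X(1)])
  then show ?thesis by blast
qed

end

section \<open>Rationality of the zeta function\<close>

lemma Ruelle_expanding_imp_locale:
  assumes "compact K" and "Ruelle_expanding K f"
  shows "\<exists>r lam c. ruelle_expanding K f r lam c"
proof -
  obtain r lam c where sep: "\<forall>x\<in>K. \<forall>y\<in>K. x \<noteq> y \<and> f x = f y \<longrightarrow> dist x y > c"
    and branch: "\<forall>x\<in>K. \<forall>a\<in>K. f a = x \<longrightarrow>
      (\<exists>phi. phi ` (ball x r \<inter> K) \<subseteq> K \<and> phi x = a \<and> (\<forall>y\<in>ball x r \<inter> K. f (phi y) = y) \<and>
        (\<forall>y\<in>ball x r \<inter> K. \<forall>z\<in>ball x r \<inter> K. dist (phi y) (phi z) \<le> lam * dist y z))"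
    and const: "0 < r" "0 < lam" "lam < 1" "0 < c" and fK: "f ` K \<subseteq> K" "continuous_on K f"
    using assms(2) unfolding Ruelle_expanding_def by (elim conjE exE) (rule that)
  have "ruelle_expanding K f r lam c"
  proof
    fix a y assume a: "a \<in> K" and y: "y \<in> K" "dist (f a) y < r"
    have fa: "f a \<in> K" using a fK by blast
    obtain phi where phi: "phi ` (ball (f a) r \<inter> K) \<subseteq> K" "phi (f a) = a"
      "\<forall>y\<in>ball (f a) r \<inter> K. f (phi y) = y"
      "\<forall>y\<in>ball (f a) r \<inter> K. \<forall>z\<in>ball (f a) r \<inter> K. dist (phi y) (phi z) \<le> lam * dist y z"
      using branch[rule_format, OF fa a refl] by (elim exE conjE) (rule that)
    have "y \<in> ball (f a) r \<inter> K" "f a \<in> ball (f a) r \<inter> K" using y fa const by auto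
    with phi(3,4) have "f (phi y) = y" "dist (phi y) (phi (f a)) \<le> lam * dist y (f a)" by blast+
    moreover have "phi y \<in> K" using phi(1) \<open>y \<in> ball (f a) r \<inter> K\<close> by blast
    ultimately show "\<exists>b\<in>K. f b = y \<and> dist b a \<le> lam * dist y (f a)"
      unfolding phi(2) by blast
  next
    fix x y assume "x \<in> K" "y \<in> K" "f x = f y" "dist x y \<le> c"
    with sep show "x = y" by (meson not_less)
  qed (use assms fK const in auto)
  then show ?thesis by blast
qed

theorem theorem1p1:
  fixes K :: "'a::metric_space set" and f :: "'a \<Rightarrow> 'a"
  assumes "compact K" and "Ruelle_expanding K f"
  shows "rational_fps (zeta_fps K f)"
proof -
  obtain r lam c where "ruelle_expanding K f r lam c"
    using Ruelle_expanding_imp_locale[OF assms] by blast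
  then obtain E :: "'a set" and B \<rho> nearby where "periodic_coding K f E B \<rho> nearby"
    using ruelle_expanding.exists_periodic_coding by blast
  then interpret periodic_coding K f E B \<rho> nearby .
  let ?W = "\<lambda>P n. closed_walks {c \<in> simplices. P (card c)} step n"
  have power_sum: "\<exists>as :: complex list. \<forall>n>0. of_nat (card (?W P n)) = (\<Sum>a\<leftarrow>as. a ^ n)" for P
    by (rule card_closed_walks_power_sum) (simp add: finite_simplices)
  obtain as :: "complex list" where as: "\<forall>n>0. of_nat (card (?W odd n)) = (\<Sum>a\<leftarrow>as. a ^ n)"
    using power_sum[of odd] by (rule exE)
  obtain bs :: "complex list" where bs: "\<forall>n>0. of_nat (card (?W even n)) = (\<Sum>b\<leftarrow>bs. b ^ n)"
    using power_sum[of even] by (rule exE)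
  have "of_nat (num_fixpoints K f n) = (\<Sum>a\<leftarrow>as. a ^ n) - (\<Sum>b\<leftarrow>bs. b ^ n)" if n: "n > 0" for n
  proof -
    have "of_nat (num_fixpoints K f n) = (of_int (int (num_fixpoints K f n)) :: complex)" by simp
    also have "\<dots> = of_nat (card (?W odd n)) - of_nat (card (?W even n))"
      unfolding num_fixpoints_eq_diff[OF n] by simp
    also have "\<dots> = (\<Sum>a\<leftarrow>as. a ^ n) - (\<Sum>b\<leftarrow>bs. b ^ n)"
      using as[rule_format, OF n] bs[rule_format, OF n] by (simp only:)
    finally show ?thesis .
  qed
  then have "zeta_fps K f = fps_exp 1 oo log_fps (\<lambda>n. (\<Sum>a\<leftarrow>as. a ^ n) - (\<Sum>b\<leftarrow>bs. b ^ n))"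
    unfolding zeta_fps_def log_fps_def by (intro arg_cong2[of _ _ _ _ fps_compose] refl fps_ext) simp
  then show ?thesis
    by (simp add: rational_exp_diff rational_exp_power_sum)
qed

end
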